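(* Let $(G,\mathcal{P})$ be a single-flow directed multipartite graph with three layers, $|V_1(G)|=a$, $|V_2(G)|=b$, $|V_3(G)|=c$, and let $g=\gcd(b,c)$ and $l=\operatorname{lcm}(b,c)$. Then $\operatorname{Pic}(G)\cong\mathbb{Z}^c\times\operatorname{Jac}(G)$, where $\operatorname{Jac}(G)\cong 0$ if $b=1$; $\operatorname{Jac}(G)\cong\mathbb{Z}_g^{\,b-2}\times\mathbb{Z}_b^{\,a-b+1}\times\mathbb{Z}_l^{\,b-2}\times\mathbb{Z}_{bc}$ if $a\ge b-1$ and $b\ge2$; $\operatorname{Jac}(G)\cong\mathbb{Z}_g^{\,a-1}\times\mathbb{Z}_c^{\,b-a-1}\times\mathbb{Z}_l^{\,a-1}\times\mathbb{Z}_{bc}$ if $a\le b-1$.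
   Context: A single-flow directed multipartite graph with $t$ layers is a directed graph $G$ with a partition $V(G)=V_1(G)\sqcup\dots\sqcup V_t(G)$ into nonempty parts such that the arrows of $G$ are exactly one one-directional arrow $u\to v$ for each $i\in\{1,\dots,t-1\}$, $u\in V_i(G)$, $v\in V_{i+1}(G)$. The Laplacian $L_G$ of a directed graph on $v_1,\dots,v_n$ is the $n\times n$ integer matrix with $(i,i)$ entry the number of outgoing arrows of $v_i$ and $(i,j)$ entry ($i\ne j$) minus the number of arrows from $v_i$ to $v_j$. $\operatorname{Pic}(G)=\mathbb{Z}^n/L_G^T\mathbb{Z}^n$, $\operatorname{Jac}(G)$ is its torsion subgroup, $\mathbb{Z}_m=\mathbb{Z}/m\mathbb{Z}$. *)

theory Defs
  imports
    "Graph_Theory.Digraph"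
    "Jordan_Normal_Form.Matrix"
    "HOL-Algebra.Product_Groups"
begin

definition num_arcs :: "('v, 'e) pre_digraph \<Rightarrow> 'v \<Rightarrow> 'v \<Rightarrow> nat" where
  "num_arcs G u v = card {e \<in> arcs G. tail G e = u \<and> head G e = v}"

text \<open>
  The layers \<open>V\<^sub>1, \<dots>, V\<^sub>t\<close> are the entries \<open>P ! 0, \<dots>, P ! (t - 1)\<close> of a list \<open>P\<close> of length \<open>t\<close>.
  Since the last condition covers all pairs of vertices, it also excludes loops, parallel arrows
  and arrows between layers other than from one layer to the next.
\<close>

definition single_flow_multipartite :: "('v, 'e) pre_digraph \<Rightarrow> 'v set list \<Rightarrow> bool" where
  "single_flow_multipartite G P \<longleftrightarrow>
     fin_digraph G \<and>
     verts G = \<Union> (set P) \<and>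
     (\<forall>i < length P. P ! i \<noteq> {}) \<and>
     (\<forall>i < length P. \<forall>j < length P. i \<noteq> j \<longrightarrow> P ! i \<inter> P ! j = {}) \<and>
     (\<forall>u \<in> verts G. \<forall>v \<in> verts G.
        num_arcs G u v =
          (if \<exists>i. Suc i < length P \<and> u \<in> P ! i \<and> v \<in> P ! Suc i then 1 else 0))"

text \<open>
  Below, \<open>vs\<close> is an enumeration \<open>v\<^sub>1, \<dots>, v\<^sub>n\<close> of the vertices, i.e. a list with
  \<open>distinct vs\<close> and \<open>set vs = verts G\<close>.
\<close>

definition laplacian :: "('v, 'e) pre_digraph \<Rightarrow> 'v list \<Rightarrow> int mat" where
  "laplacian G vs = mat (length vs) (length vs)
     (\<lambda>(i, j). if i = j then int (out_degree G (vs ! i))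
               else - int (num_arcs G (vs ! i) (vs ! j)))"

definition Pic :: "('v, 'e) pre_digraph \<Rightarrow> 'v list \<Rightarrow> int vec set monoid" where
  "Pic G vs = monoid_vec TYPE(int) (length vs) Mod
     ((\<lambda>x. transpose_mat (laplacian G vs) *\<^sub>v x) ` carrier_vec (length vs))"

definition torsion_subgroup :: "'a monoid \<Rightarrow> 'a monoid" where
  "torsion_subgroup A =
     A\<lparr>carrier := {x \<in> carrier A. \<exists>k::nat. k > 0 \<and> x [^]\<^bsub>A\<^esub> k = \<one>\<^bsub>A\<^esub>}\<rparr>"

definition Jac :: "('v, 'e) pre_digraph \<Rightarrow> 'v list \<Rightarrow> int vec set monoid" where
  "Jac G vs = torsion_subgroup (Pic G vs)"

definition group_power :: "'a monoid \<Rightarrow> nat \<Rightarrow> (nat \<Rightarrow> 'a) monoid" where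
  "group_power A k = product_group {..<k} (\<lambda>_. A)"

end

theory Submission
  imports Defs "HOL-Algebra.Multiplicative_Group"
begin

text \<open>
  \<open>Pic\<close> is generated by the vertices subject to \<open>b u = \<Sum> V\<^sub>2\<close> for \<open>u \<in> V\<^sub>1\<close> and
  \<open>c v = \<Sum> V\<^sub>3\<close> for \<open>v \<in> V\<^sub>2\<close>. Fix \<open>v0 \<in> V\<^sub>2\<close>. The elements \<open>v - v0\<close> and \<open>u - v0\<close> generate the
  torsion subgroup, with \<open>c (v - v0) = 0\<close> and \<open>b (u - v0) = D\<close>, where \<open>D\<close> is the sum of all
  \<open>v - v0\<close>, while \<open>v0\<close> and all but one of the vertices in \<open>V\<^sub>3\<close> form a basis of a free
  complement. If \<open>b \<ge> 2\<close>, then \<open>D\<close> can replace one \<open>v1 - v0\<close> as a generator, and splitting off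
  \<open>u0 - v0\<close>, which has order \<open>b c\<close>, for some \<open>u0 \<in> V\<^sub>1\<close> leaves \<open>b - 2\<close> summands of order \<open>c\<close>
  and \<open>a - 1\<close> summands \<open>u - u0\<close> of order \<open>b\<close>. The stated form results from
  \<open>\<int>\<^sub>b \<times> \<int>\<^sub>c \<cong> \<int>\<^sub>g \<times> \<int>\<^sub>l\<close>, applied to as many pairs as possible.
\<close>

section \<open>Direct products, powers of groups and cyclic factors\<close>

lemma pow_product_group:
  "x [^]\<^bsub>product_group I B\<^esub> (k::nat) = (\<lambda>i\<in>I. x i [^]\<^bsub>B i\<^esub> k)"
  by (induction k) (auto simp: nat_pow_def)

lemma pow_DirProd:
  "(x, y) [^]\<^bsub>A \<times>\<times> B\<^esub> (k::nat) = (x [^]\<^bsub>A\<^esub> k, y [^]\<^bsub>B\<^esub> k)"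
  by (induction k) (auto simp: nat_pow_def)

lemma product_group_reindex:
  assumes "bij_betw \<pi> J I"
  shows "product_group I (\<lambda>_. A) \<cong> product_group J (\<lambda>_. A)"
proof -
  let ?\<rho> = "the_inv_into J \<pi>"
  have inv: "\<And>i. i \<in> I \<Longrightarrow> \<pi> (?\<rho> i) = i \<and> ?\<rho> i \<in> J" "\<And>j. j \<in> J \<Longrightarrow> ?\<rho> (\<pi> j) = j \<and> \<pi> j \<in> I"
    using assms by (auto simp: bij_betw_def f_the_inv_into_f the_inv_into_f_f the_inv_into_into)
  have "group_isomorphisms (product_group I (\<lambda>_. A)) (product_group J (\<lambda>_. A))
     (\<lambda>f. \<lambda>j\<in>J. f (\<pi> j)) (\<lambda>f. \<lambda>i\<in>I. f (?\<rho> i))"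
    using inv unfolding group_isomorphisms_def hom_def
    by (auto simp: fun_eq_iff PiE_iff extensional_def)
  then show ?thesis
    by (meson group_isomorphisms_imp_iso is_isoI)
qed

lemma group_power_card_iso:
  assumes "finite I"
  shows "product_group I (\<lambda>_. A) \<cong> group_power A (card I)"
proof -
  obtain \<pi> where "bij_betw \<pi> {..<card I} I"
    using ex_bij_betw_nat_finite[OF assms] by (auto simp: atLeast0LessThan)
  then show ?thesis
    unfolding group_power_def by (rule product_group_reindex)
qed

lemma group_group_power [simp]: "group A \<Longrightarrow> group (group_power A k)"
  by (simp add: group_power_def)

lemma group_power_add:
  "group_power A (m + n) \<cong> group_power A m \<times>\<times> group_power A n"
proof -
  let ?L = "group_power A (m + n)" and ?R = "group_power A m \<times>\<times> group_power A n"
  let ?f = "\<lambda>f. (\<lambda>i\<in>{..<m}. f i, \<lambda>i\<in>{..<n}. f (m + i))"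
    and ?h = "\<lambda>(f, h). \<lambda>i\<in>{..<m + n}. if i < m then f i else h (i - m)"
  have "?f \<in> hom ?L ?R"
    by (rule homI) (simp_all add: group_power_def fun_eq_iff PiE_iff)
  moreover have "?h \<in> hom ?R ?L"
  proof (rule homI)
    fix p q assume "p \<in> carrier ?R" "q \<in> carrier ?R"
    then show "?h p \<in> carrier ?L"
      by (cases p) (simp add: group_power_def PiE_iff)
    show "?h (p \<otimes>\<^bsub>?R\<^esub> q) = ?h p \<otimes>\<^bsub>?L\<^esub> ?h q"
      by (cases p, cases q) (auto simp: group_power_def fun_eq_iff)
  qed
  moreover have "\<forall>x\<in>carrier ?L. ?h (?f x) = x"
    by (simp add: group_power_def fun_eq_iff PiE_iff extensional_def)
  moreover have "\<forall>y\<in>carrier ?R. ?f (?h y) = y"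
    by (auto simp: group_power_def fun_eq_iff PiE_iff extensional_def)
  ultimately have "group_isomorphisms ?L ?R ?f ?h"
    unfolding group_isomorphisms_def by blast
  then show ?thesis
    by (meson group_isomorphisms_imp_iso is_isoI)
qed

lemma group_power_DirProd:
  "group_power A n \<times>\<times> group_power B n \<cong> group_power (A \<times>\<times> B) n"
proof -
  let ?L = "group_power A n \<times>\<times> group_power B n" and ?R = "group_power (A \<times>\<times> B) n"
  let ?f = "\<lambda>(f, h). \<lambda>i\<in>{..<n}. (f i, h i)"
    and ?h = "\<lambda>f. (\<lambda>i\<in>{..<n}. fst (f i), \<lambda>i\<in>{..<n}. snd (f i))"
  have "group_isomorphisms ?L ?R ?f ?h"
  proof -
    have "?f \<in> hom ?L ?R"
    proof (rule homI)
      fix p q assume "p \<in> carrier ?L" "q \<in> carrier ?L"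
      then show "?f p \<in> carrier ?R"
        by (cases p) (simp add: group_power_def PiE_iff)
      show "?f (p \<otimes>\<^bsub>?L\<^esub> q) = ?f p \<otimes>\<^bsub>?R\<^esub> ?f q"
        by (cases p, cases q) (simp add: group_power_def fun_eq_iff)
    qed
    moreover have "?h \<in> hom ?R ?L"
      by (rule homI) (simp_all add: group_power_def fun_eq_iff PiE_iff mult_DirProd' mem_Times_iff)
    moreover have "\<forall>x\<in>carrier ?L. ?h (?f x) = x"
      by (auto simp: group_power_def fun_eq_iff PiE_iff extensional_def)
    moreover have "\<forall>y\<in>carrier ?R. ?f (?h y) = y"
      by (simp add: group_power_def fun_eq_iff PiE_iff extensional_def)
    ultimately show ?thesis
      unfolding group_isomorphisms_def by blast
  qed
  then show ?thesis
    by (meson group_isomorphisms_imp_iso is_isoI)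
qed

lemma group_power_cong:
  assumes "A \<cong> B" "group A" "group B"
  shows "group_power A n \<cong> group_power B n"
  unfolding group_power_def using assms by (intro iso_product_groupI) auto

lemma DirProd_cong:
  assumes "A \<cong> A'" "B \<cong> B'"
  shows "A \<times>\<times> B \<cong> A' \<times>\<times> B'"
proof -
  obtain f h where fh: "f \<in> iso A A'" "h \<in> iso B B'"
    using assms by (auto simp: is_iso_def)
  then have "map_prod f h \<in> iso (A \<times>\<times> B) (A' \<times>\<times> B')"
    by (auto simp: iso_def intro!: bij_betw_map_prod) (auto simp: hom_def)
  then show ?thesis
    by (rule is_isoI)
qed

text \<open>For the case \<open>a \<ge> b - 1\<close>: \<open>X\<close> and \<open>Y\<close> will be
  \<open>b - 2\<close> copies of the cyclic groups of order \<open>c\<close> and \<open>b\<close>,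
  \<open>M\<close> the surplus copies of order \<open>b\<close>, and \<open>N\<close> the cyclic
  group of order \<open>b * c\<close>. Only the pair \<open>X\<close>, \<open>Y\<close> is traded
  for \<open>P\<close>, \<open>Q\<close>.\<close>

lemma DirProd_rearrange:
  assumes "X \<times>\<times> Y \<cong> P \<times>\<times> Q"
  shows "X \<times>\<times> N \<times>\<times> Y \<times>\<times> M \<cong> P \<times>\<times> M \<times>\<times> Q \<times>\<times> N"
proof -
  have "X \<times>\<times> N \<times>\<times> Y \<times>\<times> M \<cong> (X \<times>\<times> Y) \<times>\<times> M \<times>\<times> N"
    by (rule is_isoI, rule group_isomorphisms_imp_iso
        [of _ _ "\<lambda>(x, n, y, m). ((x, y), m, n)" "\<lambda>((x, y), m, n). (x, n, y, m)"])
      (auto simp: group_isomorphisms_def hom_def)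
  also have "(X \<times>\<times> Y) \<times>\<times> M \<times>\<times> N \<cong> (P \<times>\<times> Q) \<times>\<times> M \<times>\<times> N"
    using assms by (rule DirProd_cong) simp
  also have "(P \<times>\<times> Q) \<times>\<times> M \<times>\<times> N \<cong> P \<times>\<times> M \<times>\<times> Q \<times>\<times> N"
    by (rule is_isoI, rule group_isomorphisms_imp_iso
        [of _ _ "\<lambda>((p, q), m, n). (p, m, q, n)" "\<lambda>(p, m, q, n). ((p, q), m, n)"])
      (auto simp: group_isomorphisms_def hom_def)
  finally show ?thesis .
qed

text \<open>For the case \<open>a \<le> b - 1\<close>, where the surplus \<open>M\<close> consists
  of copies of order \<open>c\<close> and hence sits beside \<open>X\<close> instead of
  \<open>Y\<close>.\<close>

lemma DirProd_rearrange':
  assumes "X \<times>\<times> Y \<cong> P \<times>\<times> Q"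
  shows "(X \<times>\<times> M) \<times>\<times> N \<times>\<times> Y \<cong> P \<times>\<times> M \<times>\<times> Q \<times>\<times> N"
proof -
  have "(X \<times>\<times> M) \<times>\<times> N \<times>\<times> Y \<cong> X \<times>\<times> N \<times>\<times> Y \<times>\<times> M"
    by (rule is_isoI, rule group_isomorphisms_imp_iso
        [of _ _ "\<lambda>((x, m), n, y). (x, n, y, m)" "\<lambda>(x, n, y, m). ((x, m), n, y)"])
      (auto simp: group_isomorphisms_def hom_def)
  also note DirProd_rearrange[OF assms]
  finally show ?thesis .
qed

text \<open>
  With \<open>u m' + v n' = 1\<close> for \<open>m' = m / g\<close> and \<open>n' = n / g\<close>, the unimodular matrix with rows
  \<open>(1, 1)\<close> and \<open>(- v n', u m')\<close> is the left factor bringing \<open>diag (m, n)\<close> to Smith normal form.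
\<close>

lemma integer_mod_group_gcd_lcm:
  assumes "m > 0" "n > 0"
  shows "integer_mod_group m \<times>\<times> integer_mod_group n
    \<cong> integer_mod_group (gcd m n) \<times>\<times> integer_mod_group (lcm m n)"
proof -
  define g where "g = gcd m n"
  obtain m' n' where mn: "m = g * m'" "n = g * n'" "coprime m' n'"
    using assms gcd_coprime_exists[of m n] unfolding g_def by (metis gcd_eq_0_iff less_irrefl mult.commute)
  have g: "g > 0" using assms by (simp add: g_def)
  have lcm: "lcm m n = g * m' * n'"
    using g mn unfolding mn(1,2) by (metis lcm_coprime lcm_mult_left mult.assoc normalize_nat_def id_apply)
  obtain u v :: int where uv: "u * int m' + v * int n' = 1"
    using mn(3) bezout_int[of "int m'" "int n'"] by (auto simp: coprime_iff_gcd_eq_1)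
  define f where "f = (\<lambda>(x, y). ((x + y) mod int g, (u * m' * y - v * n' * x) mod int (lcm m n)))"
  let ?A = "integer_mod_group m \<times>\<times> integer_mod_group n"
  let ?B = "integer_mod_group g \<times>\<times> integer_mod_group (lcm m n)"
  have pos: "lcm m n > 0" using assms by (simp add: lcm_pos_nat)
  have carA: "carrier ?A = {0..<int m} \<times> {0..<int n}"
    and carB: "carrier ?B = {0..<int g} \<times> {0..<int (lcm m n)}"
    using assms g pos by (auto simp: carrier_integer_mod_group)
  \<comment> \<open>The group law of \<open>?A\<close> reduces sums modulo \<open>m\<close> and
    \<open>n\<close>, and \<open>f\<close> must not notice this: \<open>m\<close> and
    \<open>n\<close> are multiples of \<open>g\<close>, and both \<open>n' * m\<close> and
    \<open>m' * n\<close> equal the lcm.\<close>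
  have fm: "f (x mod int m, y mod int n) = f (x, y)" for x y
  proof -
    define q r where "q = x div int m" and "r = y div int n"
    have x: "x mod int m = x - int m * q" and y: "y mod int n = y - int n * r"
      by (simp_all add: q_def r_def minus_mult_div_eq_mod)
    have "(x mod int m + y mod int n) - (x + y) = int g * (- m' * q - n' * r)"
      unfolding x y unfolding mn by (simp add: algebra_simps)
    then have 1: "int g dvd (x mod int m + y mod int n) - (x + y)"
      by simp
    have "(u * m' * (y mod int n) - v * n' * (x mod int m)) - (u * m' * y - v * n' * x)
       = int (lcm m n) * (v * q - u * r)"
      unfolding x y lcm unfolding mn by (simp add: algebra_simps)
    then have 2: "int (lcm m n) dvd (u * m' * (y mod int n) - v * n' * (x mod int m)) - (u * m' * y - v * n' * x)"
      by simp
    show ?thesis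
      using 1 2 by (simp add: f_def mod_eq_dvd_iff)
  qed
  have "f \<in> hom ?A ?B"
  proof (rule homI)
    fix p q assume "p \<in> carrier ?A" "q \<in> carrier ?A"
    show "f p \<in> carrier ?B"
      using g pos by (auto simp: f_def carB simp del: carrier_DirProd split: prod.split)
    obtain x y x' y' where [simp]: "p = (x, y)" "q = (x', y')"
      by fastforce
    have "f (p \<otimes>\<^bsub>?A\<^esub> q) = f (x + x', y + y')"
      by (simp add: fm)
    also have "\<dots> = f p \<otimes>\<^bsub>?B\<^esub> f q"
      by (simp add: f_def mod_add_eq algebra_simps)
    finally show "f (p \<otimes>\<^bsub>?A\<^esub> q) = f p \<otimes>\<^bsub>?B\<^esub> f q" .
  qed
  moreover have "inj_on f (carrier ?A)"
  proof (rule inj_onI)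
    fix p q assume pq: "p \<in> carrier ?A" "q \<in> carrier ?A" and eq: "f p = f q"
    obtain x y x' y' where [simp]: "p = (x, y)" "q = (x', y')"
      by fastforce
    define X Y where "X = x - x'" and "Y = y - y'"
    have "int g dvd X + Y"
      using eq by (simp add: f_def mod_eq_dvd_iff X_def Y_def algebra_simps)
    then obtain s where s: "X + Y = int g * s" by (elim dvdE)
    have "int (lcm m n) dvd u * m' * Y - v * n' * X"
      using eq by (simp add: f_def mod_eq_dvd_iff X_def Y_def algebra_simps)
    then obtain t where "u * m' * Y - v * n' * X = int (lcm m n) * t" by (elim dvdE)
    then have t: "u * m' * Y - v * n' * X = g * m' * n' * t"
      by (simp add: lcm)
    \<comment> \<open>The matrix of \<open>f\<close> has determinant 1, so \<open>X\<close> and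
      \<open>Y\<close> are recovered with its inverse, whose rows are \<open>(u * m', - 1)\<close>
      and \<open>(v * n', 1)\<close>.\<close>
    have "X = (u * m' + v * n') * X"
      using uv by simp
    also have "\<dots> = u * m' * (X + Y) - (u * m' * Y - v * n' * X)"
      by (simp add: algebra_simps)
    also have "\<dots> = int m * (u * s - n' * t)"
      unfolding s t mn by (simp add: algebra_simps)
    finally have "int m dvd X" by simp
    have "Y = (u * m' + v * n') * Y"
      using uv by simp
    also have "\<dots> = v * n' * (X + Y) + (u * m' * Y - v * n' * X)"
      by (simp add: algebra_simps)
    also have "\<dots> = int n * (v * s + m' * t)"
      unfolding s t mn by (simp add: algebra_simps)
    finally have "int n dvd Y" by simp
    have "x mod int m = x' mod int m" "y mod int n = y' mod int n"
      using \<open>int m dvd X\<close> \<open>int n dvd Y\<close> by (simp_all add: X_def Y_def mod_eq_dvd_iff)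
    then show "p = q"
      using pq unfolding carA by simp
  qed
  moreover have "f ` carrier ?A = carrier ?B"
  \<comment> \<open>Counting replaces an explicit preimage: \<open>f\<close> is injective, and both
    sides have \<open>m * n = gcd m n * lcm m n\<close> elements.\<close>
  proof (rule card_subset_eq)
    show "finite (carrier ?B)" unfolding carB by simp
    show "f ` carrier ?A \<subseteq> carrier ?B"
      by (intro image_subsetI hom_in_carrier[OF \<open>f \<in> hom ?A ?B\<close>])
    have "card (f ` carrier ?A) = m * n"
      using calculation(2) unfolding carA by (simp add: card_image)
    also have "\<dots> = card (carrier ?B)"
      using prod_gcd_lcm_nat[of m n] unfolding carB g_def[symmetric] by simp
    finally show "card (f ` carrier ?A) = card (carrier ?B)" .
  qed
  ultimately show ?thesis
    unfolding g_def[symmetric] by (intro is_isoI[of f]) (simp add: iso_iff)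
qed

lemma group_power_gcd_lcm:
  assumes "m > 0" "n > 0"
  shows "group_power (integer_mod_group m) k \<times>\<times> group_power (integer_mod_group n) k
    \<cong> group_power (integer_mod_group (gcd m n)) k \<times>\<times> group_power (integer_mod_group (lcm m n)) k"
proof -
  note group_power_DirProd
  also have "group_power (integer_mod_group m \<times>\<times> integer_mod_group n) k
     \<cong> group_power (integer_mod_group (gcd m n) \<times>\<times> integer_mod_group (lcm m n)) k"
    using assms by (intro group_power_cong integer_mod_group_gcd_lcm DirProd_group) auto
  also have "\<dots> \<cong> group_power (integer_mod_group (gcd m n)) k \<times>\<times> group_power (integer_mod_group (lcm m n)) k"
    by (intro group.iso_sym[OF _ group_power_DirProd] DirProd_group) auto
  finally show ?thesis .
qed

section \<open>Torsion in a product of a torsion-free and a finite group\<close>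

text \<open>Since \<open>H\<close> is torsion-free, a torsion element has trivial
  \<open>H\<close>-component; conversely, an element with trivial \<open>H\<close>-component is
  killed by the order of \<open>F\<close>. So the torsion subgroup is the kernel of the projection
  to \<open>H\<close>, which also shows that it is a group, and the projection to \<open>F\<close>
  maps it isomorphically onto \<open>F\<close>.\<close>

lemma torsion_iso:
  assumes A: "group A" and H: "group H" and F: "group F" and fin: "finite (carrier F)"
    and free: "\<And>x k. \<lbrakk>x \<in> carrier H; (k::nat) > 0; x [^]\<^bsub>H\<^esub> k = \<one>\<^bsub>H\<^esub>\<rbrakk> \<Longrightarrow> x = \<one>\<^bsub>H\<^esub>"
    and iso: "A \<cong> H \<times>\<times> F"
  shows "group (torsion_subgroup A)" "torsion_subgroup A \<cong> F"
proof -
  interpret A: group A by fact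
  interpret F: group F by fact
  obtain f where f: "f \<in> iso A (H \<times>\<times> F)"
    using iso by (auto simp: is_iso_def)
  have HF: "group (H \<times>\<times> F)"
    using H F by (rule DirProd_group)
  interpret f: group_hom A "H \<times>\<times> F" f
    using f A HF by (simp add: group_hom_def group_hom_axioms_def iso_iff)
  have inj: "inj_on f (carrier A)" and surj: "f ` carrier A = carrier H \<times> carrier F"
    using f by (auto simp: iso_iff)
  have fpow: "f (x [^]\<^bsub>A\<^esub> k) = \<one>\<^bsub>H \<times>\<times> F\<^esub> \<longleftrightarrow> x [^]\<^bsub>A\<^esub> k = \<one>\<^bsub>A\<^esub>" if "x \<in> carrier A" for x and k :: nat
    using that by (metis A.nat_pow_closed A.one_closed f.hom_one inj inj_onD)
  have tors: "(\<exists>k::nat. k > 0 \<and> x [^]\<^bsub>A\<^esub> k = \<one>\<^bsub>A\<^esub>) \<longleftrightarrow> fst (f x) = \<one>\<^bsub>H\<^esub>" if x: "x \<in> carrier A" for x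
  proof -
    have fx: "fst (f x) \<in> carrier H" "snd (f x) \<in> carrier F"
      using f.hom_closed[OF x] by auto
    have pow: "f (x [^]\<^bsub>A\<^esub> k) = (fst (f x) [^]\<^bsub>H\<^esub> k, snd (f x) [^]\<^bsub>F\<^esub> k)" for k :: nat
      using f.hom_nat_pow[OF x, of k] pow_DirProd[where x = "fst (f x)" and y = "snd (f x)"]
      by simp
    show ?thesis
    proof
      assume "\<exists>k::nat. k > 0 \<and> x [^]\<^bsub>A\<^esub> k = \<one>\<^bsub>A\<^esub>"
      then obtain k :: nat where "k > 0" "x [^]\<^bsub>A\<^esub> k = \<one>\<^bsub>A\<^esub>" by blast
      then show "fst (f x) = \<one>\<^bsub>H\<^esub>"
        using fpow[OF x, of k] pow[of k] free[OF fx(1)] by simp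
    next
      assume 1: "fst (f x) = \<one>\<^bsub>H\<^esub>"
      have "f (x [^]\<^bsub>A\<^esub> order F) = \<one>\<^bsub>H \<times>\<times> F\<^esub>"
        using fx H by (simp add: pow 1 F.pow_order_eq_1 group.is_monoid monoid.nat_pow_one)
      then show "\<exists>k::nat. k > 0 \<and> x [^]\<^bsub>A\<^esub> k = \<one>\<^bsub>A\<^esub>"
        using fpow[OF x] fin F.order_gt_0_iff_finite by blast
    qed
  qed
  let ?T = "torsion_subgroup A"
  have carT: "carrier ?T = {x \<in> carrier A. fst (f x) = \<one>\<^bsub>H\<^esub>}"
    using tors by (auto simp: torsion_subgroup_def)
  have mulT: "x \<otimes>\<^bsub>?T\<^esub> y = x \<otimes>\<^bsub>A\<^esub> y" for x y
    by (simp add: torsion_subgroup_def)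
  have "group_hom A H (\<lambda>x. fst (f x))"
    using A H f.hom_closed f.hom_mult
    by (simp add: group_hom_def group_hom_axioms_def hom_def mult_DirProd' mem_Times_iff)
  then have "subgroup (carrier ?T) A"
    using group_hom.subgroup_kernel[of A H "\<lambda>x. fst (f x)"] by (simp add: kernel_def carT)
  then show "group ?T"
    using A.subgroup_imp_group by (simp add: torsion_subgroup_def)
  have "(\<lambda>x. snd (f x)) \<in> hom ?T F"
    using f.hom_closed by (simp add: hom_def carT mulT mult_DirProd' mem_Times_iff)
  moreover have "inj_on (\<lambda>x. snd (f x)) (carrier ?T)"
    using inj by (auto simp: inj_on_def carT prod_eq_iff)
  moreover have "(\<lambda>x. snd (f x)) ` carrier ?T = carrier F"
  proof
    show "(\<lambda>x. snd (f x)) ` carrier ?T \<subseteq> carrier F"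
      using calculation(1) by (auto simp: hom_def)
    show "carrier F \<subseteq> (\<lambda>x. snd (f x)) ` carrier ?T"
    proof
      fix y assume "y \<in> carrier F"
      then have "(\<one>\<^bsub>H\<^esub>, y) \<in> f ` carrier A"
        unfolding surj using H by (simp add: group.is_monoid monoid.one_closed)
      then obtain x where "x \<in> carrier A" "f x = (\<one>\<^bsub>H\<^esub>, y)" by auto
      then show "y \<in> (\<lambda>x. snd (f x)) ` carrier ?T"
        by (intro image_eqI[of _ _ x]) (auto simp: carT)
    qed
  qed
  ultimately show "?T \<cong> F"
    by (intro is_isoI[of "\<lambda>x. snd (f x)"]) (simp add: iso_iff)
qed

lemma group_power_integer_torsion_free:
  assumes "x \<in> carrier (group_power integer_group n)" "(k::nat) > 0"
    and "x [^]\<^bsub>group_power integer_group n\<^esub> k = \<one>\<^bsub>group_power integer_group n\<^esub>"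
  shows "x = \<one>\<^bsub>group_power integer_group n\<^esub>"
proof -
  have "(\<lambda>i\<in>{..<n}. int k * x i) = (\<lambda>i\<in>{..<n}. 0)"
    using assms(3) by (simp add: group_power_def pow_product_group)
  then have "x i = 0" if "i < n" for i
    using that assms(2) by (auto dest!: fun_cong[of _ _ i])
  then show ?thesis
    using assms(1) by (auto simp: group_power_def fun_eq_iff PiE_iff extensional_def)
qed

section \<open>The Picard group as a quotient by the Laplacian relations\<close>

lemma out_degree_eq_sum_num_arcs:
  assumes "fin_digraph G"
  shows "out_degree G v = (\<Sum>w\<in>verts G. num_arcs G v w)"
proof -
  interpret fin_digraph G by fact
  have "out_degree G v = (\<Sum>w\<in>verts G. \<Sum>e\<in>{e \<in> out_arcs G v. head G e = w}. 1)"
    unfolding out_degree_def card_eq_sum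
    by (rule sum.group[symmetric]) auto
  also have "\<dots> = (\<Sum>w\<in>verts G. num_arcs G v w)"
    by (simp add: num_arcs_def out_arcs_def)
  finally show ?thesis .
qed

text \<open>The first isomorphism theorem, for a map given on functions on vertices rather than on
  vectors, so that later computations are free of the enumeration \<open>vs\<close>. By
  \<open>cong\<close> only the values on vertices count. In \<open>kernel\<close>, \<open>m\<close>
  is the argument of the transposed Laplacian.\<close>

lemma Pic_iso:
  fixes \<psi> :: "('v \<Rightarrow> int) \<Rightarrow> 'h"
  assumes vs: "distinct vs" "set vs = verts G"
    and H: "group H"
    and closed: "\<And>x. \<psi> x \<in> carrier H"
    and add: "\<And>x y. \<psi> (\<lambda>v. x v + y v) = \<psi> x \<otimes>\<^bsub>H\<^esub> \<psi> y"
    and cong: "\<And>x y. (\<And>v. v \<in> verts G \<Longrightarrow> x v = y v) \<Longrightarrow> \<psi> x = \<psi> y"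
    and surj: "\<And>z. z \<in> carrier H \<Longrightarrow> \<exists>x. \<psi> x = z"
    and kernel: "\<And>x. \<psi> x = \<one>\<^bsub>H\<^esub> \<longleftrightarrow> (\<exists>m. \<forall>v\<in>verts G.
       x v = int (out_degree G v) * m v - (\<Sum>u\<in>verts G - {v}. int (num_arcs G u v) * m u))"
  shows "group (Pic G vs)" "Pic G vs \<cong> H"
proof -
  define n where "n = length vs"
  \<comment> \<open>\<open>val\<close> reads a vector as a function on vertices through the position
    \<open>pos v\<close> of \<open>v\<close> in \<open>vs\<close>. Outside \<open>verts G\<close>
    its values are unspecified, which \<open>cong\<close> absorbs.\<close>
  define pos where "pos = the_inv_into {..<n} ((!) vs)"
  define val where "val = (\<lambda>(x :: int vec) v. x $ pos v)"
  let ?Z = "monoid_vec TYPE(int) n"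
  let ?L = "transpose_mat (laplacian G vs)"
  have fin: "finite (verts G)"
    unfolding vs(2)[symmetric] by simp
  have bij: "bij_betw ((!) vs) {..<n} (verts G)"
    using vs bij_betw_nth[of vs "{..<n}" "verts G"] by (simp add: n_def)
  have nth: "vs ! i \<in> verts G" "pos (vs ! i) = i" if "i < n" for i
    using that bij by (auto simp: pos_def bij_betw_def the_inv_into_f_f)
  have pos: "pos v < n" "vs ! pos v = v" if "v \<in> verts G" for v
    using that bij the_inv_into_into[of "(!) vs" "{..<n}" v "{..<n}"]
    by (auto simp: pos_def bij_betw_def f_the_inv_into_f)
  have val_vec: "val (vec n (\<lambda>i. f (vs ! i))) v = f v" if "v \<in> verts G" for f v
    using that pos by (simp add: val_def)
  have vec_eqI: "x = y" if "x \<in> carrier_vec n" "y \<in> carrier_vec n"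
    "\<And>v. v \<in> verts G \<Longrightarrow> val x v = val y v" for x y
    using that(1,2) that(3)[OF nth(1)] by (auto simp: val_def nth intro!: eq_vecI)
  have val_lap: "val (?L *\<^sub>v y) v = int (out_degree G v) * val y v
      - (\<Sum>u\<in>verts G - {v}. int (num_arcs G u v) * val y u)"
    if y: "y \<in> carrier_vec n" and v: "v \<in> verts G" for y v
  proof -
    let ?a = "\<lambda>u. if u = v then int (out_degree G u) else - int (num_arcs G u v)"
    have dims: "dim_row (laplacian G vs) = n" "dim_col (laplacian G vs) = n" "dim_vec y = n"
      using y by (simp_all add: laplacian_def n_def)
    have "val (?L *\<^sub>v y) v = (\<Sum>i\<in>{..<n}. laplacian G vs $$ (i, pos v) * y $ i)"
      using pos[OF v] by (simp add: val_def dims scalar_prod_def atLeast0LessThan)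
    also have "\<dots> = (\<Sum>i\<in>{..<n}. ?a (vs ! i) * val y (vs ! i))"
      using pos[OF v] nth by (intro sum.cong) (auto simp: laplacian_def n_def val_def)
    also have "\<dots> = (\<Sum>u\<in>verts G. ?a u * val y u)"
      using bij by (rule sum.reindex_bij_betw)
    also have "\<dots> = ?a v * val y v + (\<Sum>u\<in>verts G - {v}. ?a u * val y u)"
      using v fin by (rule sum.remove[rotated])
    also have "(\<Sum>u\<in>verts G - {v}. ?a u * val y u)
      = - (\<Sum>u\<in>verts G - {v}. int (num_arcs G u v) * val y u)"
      unfolding sum_negf[symmetric] by (intro sum.cong) auto
    finally show ?thesis by simp
  qed
  have L_carrier: "?L *\<^sub>v y \<in> carrier_vec n" for y
    by (rule carrier_vecI) (simp add: laplacian_def n_def)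
  interpret group_hom ?Z H "\<lambda>x. \<psi> (val x)"
  proof -
    have "\<psi> (val (x + y)) = \<psi> (val x) \<otimes>\<^bsub>H\<^esub> \<psi> (val y)"
      if "x \<in> carrier_vec n" "y \<in> carrier_vec n" for x y
      unfolding add[symmetric] using that pos by (intro cong) (auto simp: val_def)
    then show "group_hom ?Z H (\<lambda>x. \<psi> (val x))"
      using H closed comm_group_vec[of n, where 'a = int]
      by (auto simp: group_hom_def group_hom_axioms_def hom_def monoid_vec_simps comm_group_def)
  qed
  have "kernel ?Z H (\<lambda>x. \<psi> (val x)) = (\<lambda>y. ?L *\<^sub>v y) ` carrier_vec n"
  proof (intro equalityI subsetI)
    fix x assume "x \<in> kernel ?Z H (\<lambda>x. \<psi> (val x))"
    then have x: "x \<in> carrier_vec n" "\<psi> (val x) = \<one>\<^bsub>H\<^esub>"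
      by (auto simp: kernel_def monoid_vec_simps)
    then obtain m where m: "\<forall>v\<in>verts G. val x v = int (out_degree G v) * m v
        - (\<Sum>u\<in>verts G - {v}. int (num_arcs G u v) * m u)"
      unfolding kernel by blast
    let ?y = "vec n (\<lambda>i. m (vs ! i))"
    have "val x v = val (?L *\<^sub>v ?y) v" if "v \<in> verts G" for v
    proof -
      have "(\<Sum>u\<in>verts G - {v}. int (num_arcs G u v) * val ?y u)
        = (\<Sum>u\<in>verts G - {v}. int (num_arcs G u v) * m u)"
        by (intro sum.cong) (auto simp: val_vec)
      then show ?thesis
        using that m by (simp add: val_lap val_vec)
    qed
    then have "x = ?L *\<^sub>v ?y"
      using x(1) L_carrier by (intro vec_eqI) auto
    then show "x \<in> (\<lambda>y. ?L *\<^sub>v y) ` carrier_vec n" by auto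
  next
    fix x assume "x \<in> (\<lambda>y. ?L *\<^sub>v y) ` carrier_vec n"
    then obtain y where "x = ?L *\<^sub>v y" "y \<in> carrier_vec n" by auto
    then show "x \<in> kernel ?Z H (\<lambda>x. \<psi> (val x))"
      using L_carrier val_lap by (auto simp: kernel_def monoid_vec_simps kernel intro!: exI[of _ "val y"])
  qed
  moreover have "(\<lambda>x. \<psi> (val x)) ` carrier ?Z = carrier H"
  proof (intro equalityI subsetI)
    fix z assume "z \<in> carrier H"
    then obtain x where "\<psi> x = z" using surj by blast
    then have "\<psi> (val (vec n (\<lambda>i. x (vs ! i)))) = z"
      using cong[of "val (vec n (\<lambda>i. x (vs ! i)))" x] val_vec by simp
    then show "z \<in> (\<lambda>x. \<psi> (val x)) ` carrier ?Z"
      by (intro image_eqI[of _ _ "vec n (\<lambda>i. x (vs ! i))"]) (auto simp: monoid_vec_simps)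
  qed (use closed in auto)
  ultimately show "group (Pic G vs)" "Pic G vs \<cong> H"
    using FactGroup_iso normal.factorgroup_is_group[OF normal_kernel]
    by (simp_all add: Pic_def n_def)
qed

section \<open>The Laplacian relations for three layers\<close>

lemma single_flow_three_layers:
  assumes "single_flow_multipartite G [V1, V2, V3]"
  shows "verts G = V1 \<union> V2 \<union> V3" "finite V1" "finite V2" "finite V3"
    "V1 \<noteq> {}" "V2 \<noteq> {}" "V3 \<noteq> {}"
    "V1 \<inter> V2 = {}" "V1 \<inter> V3 = {}" "V2 \<inter> V3 = {}"
proof -
  note sf = assms[unfolded single_flow_multipartite_def]
  interpret fin_digraph G using sf by blast
  show "verts G = V1 \<union> V2 \<union> V3" using sf by auto
  then show "finite V1" "finite V2" "finite V3"
    using finite_verts by auto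
  have "\<forall>i<3. [V1, V2, V3] ! i \<noteq> {}"
    using sf by simp
  then show "V1 \<noteq> {}" "V2 \<noteq> {}" "V3 \<noteq> {}"
    by (auto simp: numeral_3_eq_3 All_less_Suc)
  have "\<forall>i<3. \<forall>j<3. i \<noteq> j \<longrightarrow> [V1, V2, V3] ! i \<inter> [V1, V2, V3] ! j = {}"
    using sf by simp
  then show "V1 \<inter> V2 = {}" "V1 \<inter> V3 = {}" "V2 \<inter> V3 = {}"
    by (auto simp: numeral_3_eq_3 All_less_Suc)
qed

text \<open>A vertex of \<open>V1\<close> has \<open>card V2\<close> outgoing and no incoming
  arrows; one of \<open>V2\<close> has \<open>card V3\<close> outgoing arrows and one incoming from
  each vertex of \<open>V1\<close>; one of \<open>V3\<close> has only incoming arrows, one from each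
  vertex of \<open>V2\<close>.\<close>

lemma laplacian_three_layers:
  fixes m :: "'v \<Rightarrow> int"
  assumes sf: "single_flow_multipartite G [V1, V2, V3]" and v: "v \<in> verts G"
  shows "int (out_degree G v) * m v - (\<Sum>u\<in>verts G - {v}. int (num_arcs G u v) * m u)
    = (if v \<in> V1 then int (card V2) * m v
       else if v \<in> V2 then int (card V3) * m v - sum m V1
       else - sum m V2)"
proof -
  note layers = single_flow_three_layers[OF sf]
  have fin: "fin_digraph G"
    using sf by (simp add: single_flow_multipartite_def)
  have ex: "(\<exists>i. Suc i < length [V1, V2, V3] \<and> u \<in> [V1, V2, V3] ! i \<and> w \<in> [V1, V2, V3] ! Suc i)
     \<longleftrightarrow> u \<in> V1 \<and> w \<in> V2 \<or> u \<in> V2 \<and> w \<in> V3" for u w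
    by (auto simp: less_Suc_eq)
  have arcs: "num_arcs G u w = of_bool (u \<in> V1 \<and> w \<in> V2 \<or> u \<in> V2 \<and> w \<in> V3)"
    if "u \<in> verts G" "w \<in> verts G" for u w
    using that sf unfolding single_flow_multipartite_def ex by simp
  have "(\<Sum>u\<in>verts G - {v}. int (num_arcs G u v) * m u)
     = (\<Sum>u\<in>verts G - {v}. if u \<in> V1 \<and> v \<in> V2 \<or> u \<in> V2 \<and> v \<in> V3 then m u else 0)"
    using v by (intro sum.cong) (auto simp: arcs)
  also have "\<dots> = (\<Sum>u\<in>{u \<in> verts G - {v}. u \<in> V1 \<and> v \<in> V2 \<or> u \<in> V2 \<and> v \<in> V3}. m u)"
    using layers by (intro sum.inter_filter[symmetric]) auto
  also have "{u \<in> verts G - {v}. u \<in> V1 \<and> v \<in> V2 \<or> u \<in> V2 \<and> v \<in> V3}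
     = (if v \<in> V1 then {} else if v \<in> V2 then V1 else V2)"
    using v layers by auto
  finally have in_sum: "(\<Sum>u\<in>verts G - {v}. int (num_arcs G u v) * m u)
     = sum m (if v \<in> V1 then {} else if v \<in> V2 then V1 else V2)" .
  have "out_degree G v = (\<Sum>w\<in>verts G. of_bool (v \<in> V1 \<and> w \<in> V2 \<or> v \<in> V2 \<and> w \<in> V3))"
    unfolding out_degree_eq_sum_num_arcs[OF fin] using v by (intro sum.cong) (auto simp: arcs)
  also have "\<dots> = card {w \<in> verts G. v \<in> V1 \<and> w \<in> V2 \<or> v \<in> V2 \<and> w \<in> V3}"
    using layers by (simp add: of_bool_def sum.If_cases Int_def)
  also have "{w \<in> verts G. v \<in> V1 \<and> w \<in> V2 \<or> v \<in> V2 \<and> w \<in> V3}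
     = (if v \<in> V1 then V2 else if v \<in> V2 then V3 else {})"
    using layers by auto
  finally show ?thesis
    using in_sum by simp
qed

text \<open>The common frame for the coordinate systems in the cases \<open>b \<ge> 2\<close> and
  \<open>b = 1\<close>. The Laplacian rows at \<open>V3\<close> vanish, so only the values of
  \<open>m\<close> on \<open>V1\<close> and \<open>V2\<close> enter.\<close>

lemma Pic_three_layers_iso:
  fixes \<psi> :: "('v \<Rightarrow> int) \<Rightarrow> 'h"
  assumes sf: "single_flow_multipartite G [V1, V2, V3]"
    and vs: "distinct vs" "set vs = verts G"
    and H: "group H"
    and closed: "\<And>x. \<psi> x \<in> carrier H"
    and add: "\<And>x y. \<psi> (\<lambda>v. x v + y v) = \<psi> x \<otimes>\<^bsub>H\<^esub> \<psi> y"
    and cong: "\<And>x y. (\<And>v. v \<in> V1 \<union> V2 \<union> V3 \<Longrightarrow> x v = y v) \<Longrightarrow> \<psi> x = \<psi> y"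
    and surj: "\<And>z. z \<in> carrier H \<Longrightarrow> \<exists>x. \<psi> x = z"
    and kernel: "\<And>x. \<psi> x = \<one>\<^bsub>H\<^esub> \<longleftrightarrow> (\<exists>m.
       (\<forall>u\<in>V1. x u = int (card V2) * m u) \<and>
       (\<forall>v\<in>V2. x v = int (card V3) * m v - sum m V1) \<and>
       (\<forall>w\<in>V3. x w = - sum m V2))"
  shows "group (Pic G vs)" "Pic G vs \<cong> H"
proof -
  note layers = single_flow_three_layers[OF sf]
  have ker: "\<psi> x = \<one>\<^bsub>H\<^esub> \<longleftrightarrow> (\<exists>m. \<forall>v\<in>verts G.
       x v = int (out_degree G v) * m v - (\<Sum>u\<in>verts G - {v}. int (num_arcs G u v) * m u))" for x
  proof -
    have "(\<forall>v\<in>verts G. x v = int (out_degree G v) * m v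
        - (\<Sum>u\<in>verts G - {v}. int (num_arcs G u v) * m u))
      \<longleftrightarrow> (\<forall>v\<in>verts G. x v = (if v \<in> V1 then int (card V2) * m v
         else if v \<in> V2 then int (card V3) * m v - sum m V1 else - sum m V2))" for m
      by (intro ball_cong refl) (simp add: laplacian_three_layers[OF sf])
    also have "\<dots> m \<longleftrightarrow> (\<forall>u\<in>V1. x u = int (card V2) * m u) \<and>
       (\<forall>v\<in>V2. x v = int (card V3) * m v - sum m V1) \<and> (\<forall>w\<in>V3. x w = - sum m V2)" for m
      unfolding layers(1) ball_Un conj_assoc using layers(8-10)
      by (intro conj_cong ball_cong refl) auto
    finally show ?thesis
      unfolding kernel by simp
  qed
  have cong': "\<psi> x = \<psi> y" if "\<And>v. v \<in> verts G \<Longrightarrow> x v = y v" for x y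
    using that layers(1) by (intro cong) auto
  show "group (Pic G vs)" "Pic G vs \<cong> H"
    using Pic_iso[OF vs H, of \<psi>] closed add cong' surj ker by blast+
qed

text \<open>
  The congruence at \<open>v0\<close> follows from the vanishing of the weighted coordinate sum, and the
  divisibility at \<open>u0\<close> from the divisibility by \<open>b * c\<close>, so both are absent on the right.
\<close>

lemma laplacian_image_iff:
  fixes x :: "'v \<Rightarrow> int" and V1 V2 V3 :: "'v set"
  defines "b \<equiv> int (card V2)" and "c \<equiv> int (card V3)"
  assumes fin: "finite V1" "finite V2" "finite V3"
    and disj: "V1 \<inter> V2 = {}"
    and u0: "u0 \<in> V1" and v01: "v0 \<in> V2" "v1 \<in> V2" "v0 \<noteq> v1" and w0: "w0 \<in> V3"
  shows "(\<exists>m. (\<forall>u\<in>V1. x u = b * m u) \<and> (\<forall>v\<in>V2. x v = c * m v - sum m V1)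
      \<and> (\<forall>w\<in>V3. x w = - sum m V2))
    \<longleftrightarrow> (\<forall>w\<in>V3. x w = x w0) \<and> c * x w0 + sum x V2 + sum x V1 = 0
      \<and> (\<forall>v\<in>V2 - {v0, v1}. c dvd x v - x v1)
      \<and> b * c dvd b * x v1 + sum x V1 \<and> (\<forall>u\<in>V1 - {u0}. b dvd x u)" (is "?L \<longleftrightarrow> ?R")
proof
  assume ?L
  then obtain m where m: "\<And>u. u \<in> V1 \<Longrightarrow> x u = b * m u"
    "\<And>v. v \<in> V2 \<Longrightarrow> x v = c * m v - sum m V1" "\<And>w. w \<in> V3 \<Longrightarrow> x w = - sum m V2"
    by blast
  have sum1: "sum x V1 = b * sum m V1"
    by (simp add: m(1) sum_distrib_left)
  have sum2: "sum x V2 = c * sum m V2 - b * sum m V1"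
    by (simp add: m(2) sum_distrib_left sum_subtractf b_def)
  have "b * x v1 + sum x V1 = b * c * m v1"
    using v01 by (simp add: m(2) sum1 algebra_simps)
  moreover have "x v - x v1 = c * (m v - m v1)" if "v \<in> V2" for v
    using that v01 by (simp add: m(2) algebra_simps)
  moreover have "b dvd x u" if "u \<in> V1" for u
    using that by (simp add: m(1))
  moreover have "c * x w0 + sum x V2 + sum x V1 = 0"
    using w0 by (simp add: m(3) sum1 sum2)
  ultimately show ?R
    using w0 v01 by (auto simp: m(3))
next
  assume R: ?R
  have b: "b > 0" and c: "c > 0"
    using fin v01 w0 by (auto simp: b_def c_def card_gt_0_iff)
  have sum_x1: "sum x V1 = x u0 + sum x (V1 - {u0})"
    using fin(1) u0 by (rule sum.remove)
  have "b * c dvd b * x v1 + sum x V1"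
    using R by blast
  then have "b dvd b * x v1 + sum x V1"
    by (rule dvd_mult_left)
  then have "b dvd x u0 + sum x (V1 - {u0})"
    unfolding sum_x1 by (simp add: dvd_add_right_iff)
  moreover have "b dvd sum x (V1 - {u0})"
    using R by (intro dvd_sum) blast
  ultimately have "b dvd x u0"
    by (simp add: dvd_add_left_iff)
  then have dvd1: "b dvd x u" if "u \<in> V1" for u
    using R that by (cases "u = u0") auto
  \<comment> \<open>\<open>M\<close> is the sum over \<open>V1\<close> of the wanted
    \<open>m\<close>, which is forced to be \<open>x u div b\<close> there. The equations on
    \<open>V2\<close> then read \<open>x v + M = c * m v\<close>.\<close>
  define M where "M = (\<Sum>u\<in>V1. x u div b)"
  have sum1: "sum x V1 = b * M"
    unfolding M_def sum_distrib_left using dvd1 by (intro sum.cong) auto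
  have "b * c dvd b * (x v1 + M)"
    using R by (simp add: sum1 algebra_simps)
  then have dvd_v1: "c dvd x v1 + M"
    using b by simp
  have dvd2: "c dvd x v + M" if "v \<in> V2 - {v0}" for v
  proof (cases "v = v1")
    case False
    then have "c dvd x v - x v1"
      using R that by blast
    from dvd_add[OF this dvd_v1] show ?thesis by simp
  qed (use dvd_v1 in simp)
  define N where "N = (\<Sum>v\<in>V2 - {v0}. (x v + M) div c)"
  have cN: "c * N = (\<Sum>v\<in>V2 - {v0}. x v + M)"
    unfolding N_def sum_distrib_left using dvd2 by (intro sum.cong) auto
  \<comment> \<open>On \<open>V2 - {v0}\<close> the quotients by \<open>c\<close> are forced, with
    sum \<open>N\<close>. The value at \<open>v0\<close> makes \<open>m\<close> sum to
    \<open>- x w0\<close> over \<open>V2\<close>, as the equations on \<open>V3\<close> demand; the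
    equation at \<open>v0\<close> itself then has to be verified.\<close>
  define m where "m = (\<lambda>v. if v \<in> V1 then x v div b
    else if v = v0 then - x w0 - N else (x v + M) div c)"
  have m1: "sum m V1 = M"
    unfolding M_def by (intro sum.cong) (auto simp: m_def)
  have notin: "v \<notin> V1" if "v \<in> V2" for v
    using that disj by auto
  have "sum m (V2 - {v0}) = N"
    unfolding N_def using notin by (intro sum.cong) (auto simp: m_def)
  then have m2: "sum m V2 = - x w0"
    using sum.remove[OF fin(2) v01(1), of m] notin[OF v01(1)] by (simp add: m_def)
  \<comment> \<open>Because the weighted sum vanishes, the terms \<open>x v + M\<close> add up to
    \<open>- c * x w0\<close> over \<open>V2\<close>. Those with \<open>v\<close> other than
    \<open>v0\<close> contribute \<open>c * N\<close>, so the term at \<open>v0\<close> is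
    \<open>c * m v0\<close>.\<close>
  have v0: "x v0 = c * m v0 - M"
  proof -
    have "(\<Sum>v\<in>V2. x v + M) = sum x V2 + b * M"
      by (simp add: sum.distrib b_def)
    also have "\<dots> = - c * x w0"
      using R sum1 by (simp add: algebra_simps)
    finally have "x v0 + M + c * N = - c * x w0"
      using sum.remove[OF fin(2) v01(1), of "\<lambda>v. x v + M"] cN by simp
    then show ?thesis
      using notin[OF v01(1)] by (simp add: m_def algebra_simps)
  qed
  have "x v = c * m v - sum m V1" if "v \<in> V2" for v
    unfolding m1 using that v0 dvd2[of v] notin[of v] by (cases "v = v0") (auto simp: m_def)
  moreover have "x u = b * m u" if "u \<in> V1" for u
    using that dvd1 by (simp add: m_def)
  moreover have "x w = - sum m V2" if "w \<in> V3" for w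
    using that R by (simp add: m2)
  ultimately show ?L by blast
qed

section \<open>Coordinates on the Picard group\<close>

lemma mod_in_integer_mod_group: "x mod int n \<in> carrier (integer_mod_group n)"
  by (simp add: carrier_integer_mod_group)

lemma mod_eq_of_integer_mod_group: "x \<in> carrier (integer_mod_group n) \<Longrightarrow> x mod int n = x"
  by (auto simp: carrier_integer_mod_group split: if_splits)

text \<open>The coordinates are chosen so that their simultaneous vanishing is the right-hand side
  of \<open>laplacian_image_iff\<close>. The first factor of \<open>H\<close> is the free part, the
  other three carry the torsion.\<close>

lemma Pic_iso_middle_layer_ge_2:
  assumes sf: "single_flow_multipartite G [V1, V2, V3]"
    and vs: "distinct vs" "set vs = verts G"
    and u0: "u0 \<in> V1" and v01: "v0 \<in> V2" "v1 \<in> V2" "v0 \<noteq> v1" and w0: "w0 \<in> V3"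
  defines "b \<equiv> card V2" and "c \<equiv> card V3"
  defines "H \<equiv> product_group V3 (\<lambda>_. integer_group)
    \<times>\<times> product_group (V2 - {v0, v1}) (\<lambda>_. integer_mod_group c)
    \<times>\<times> integer_mod_group (b * c) \<times>\<times> product_group (V1 - {u0}) (\<lambda>_. integer_mod_group b)"
  shows "group (Pic G vs)" "Pic G vs \<cong> H"
proof -
  note layers = single_flow_three_layers[OF sf]
  \<comment> \<open>The coordinate at \<open>w0\<close> is the sum of \<open>x\<close> over all
    vertices, less the other coordinates \<open>x w - x w0\<close>.\<close>
  define free where "free = (\<lambda>x. \<lambda>w\<in>V3.
    if w = w0 then int c * x w0 + sum x V2 + sum x V1 else x w - x w0)"
  \<comment> \<open>Coefficients after the change of generators: writing \<open>v1 - v0\<close> as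
    \<open>D\<close> minus the other \<open>v - v0\<close> turns \<open>x v\<close> into
    \<open>x v - x v1\<close>. Then \<open>D = b (u0 - v0)\<close> and
    \<open>u - v0 = (u - u0) + (u0 - v0)\<close> collect \<open>b * x v1 + sum x V1\<close> at
    \<open>u0 - v0\<close> and leave \<open>x u\<close> at \<open>u - u0\<close>.\<close>
  define tors where "tors = (\<lambda>x. (\<lambda>v\<in>V2 - {v0, v1}. (x v - x v1) mod int c,
    (int b * x v1 + sum x V1) mod int (b * c), \<lambda>u\<in>V1 - {u0}. x u mod int b))"
  let ?\<psi> = "\<lambda>x. (free x, tors x)"
  have "group H"
    unfolding H_def by (intro DirProd_group product_group) auto
  moreover have "?\<psi> x \<in> carrier H" for x
    by (auto simp: H_def free_def tors_def mod_in_integer_mod_group simp del: of_nat_mult)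
  moreover have "?\<psi> (\<lambda>v. x v + y v) = ?\<psi> x \<otimes>\<^bsub>H\<^esub> ?\<psi> y" for x y
    by (simp add: H_def free_def tors_def fun_eq_iff sum.distrib mod_add_eq algebra_simps
        del: of_nat_mult)
  moreover have "?\<psi> x = ?\<psi> y" if "\<And>v. v \<in> V1 \<union> V2 \<union> V3 \<Longrightarrow> x v = y v" for x y
  proof -
    have "sum x V1 = sum y V1" "sum x V2 = sum y V2"
      using that by (auto intro!: sum.cong)
    then show ?thesis
      using that v01 w0 by (auto simp: free_def tors_def fun_eq_iff)
  qed
  moreover have "\<exists>x. ?\<psi> x = z" if "z \<in> carrier H" for z
  proof -
    obtain \<alpha> \<gamma> \<delta> \<epsilon> where z: "z = (\<alpha>, \<gamma>, \<delta>, \<epsilon>)" by (metis prod_cases4)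
    have \<alpha>: "\<alpha> \<in> extensional V3"
      and \<gamma>: "\<gamma> \<in> extensional (V2 - {v0, v1})"
        "\<And>v. v \<in> V2 - {v0, v1} \<Longrightarrow> \<gamma> v mod int c = \<gamma> v"
      and \<delta>: "\<delta> mod int (b * c) = \<delta>"
      and \<epsilon>: "\<epsilon> \<in> extensional (V1 - {u0})"
        "\<And>u. u \<in> V1 - {u0} \<Longrightarrow> \<epsilon> u mod int b = \<epsilon> u"
      using that by (auto simp: z H_def PiE_iff mod_eq_of_integer_mod_group simp del: of_nat_mult)
    \<comment> \<open>Zeros at \<open>w0\<close> and \<open>v1\<close> turn the differences into
      plain values. The value at \<open>u0\<close> makes the sum over \<open>V1\<close> equal to
      \<open>\<delta>\<close>, and the one at \<open>v0\<close> then makes the weighted sum equal to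
      \<open>\<alpha> w0\<close>.\<close>
    define x where "x = (\<lambda>v. if v \<in> V3 then if v = w0 then 0 else \<alpha> v
      else if v \<in> V2 then if v = v1 then 0 else if v = v0 then \<alpha> w0 - sum \<gamma> (V2 - {v0, v1}) - \<delta> else \<gamma> v
      else if v = u0 then \<delta> - sum \<epsilon> (V1 - {u0}) else \<epsilon> v)"
    have x3: "x w = (if w = w0 then 0 else \<alpha> w)" if "w \<in> V3" for w
      using that by (simp add: x_def)
    have x2: "x v = (if v = v1 then 0 else if v = v0 then \<alpha> w0 - sum \<gamma> (V2 - {v0, v1}) - \<delta> else \<gamma> v)"
      if "v \<in> V2" for v
    proof -
      have "v \<notin> V3" using that layers(10) by blast
      then show ?thesis using that by (simp add: x_def)
    qed
    have x1: "x u = (if u = u0 then \<delta> - sum \<epsilon> (V1 - {u0}) else \<epsilon> u)" if "u \<in> V1" for u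
    proof -
      have "u \<notin> V2" "u \<notin> V3" using that layers(8,9) by blast+
      then show ?thesis by (simp add: x_def)
    qed
    have "sum x (V1 - {u0}) = sum \<epsilon> (V1 - {u0})"
      using x1 by (intro sum.cong) auto
    then have sum1: "sum x V1 = \<delta>"
      using sum.remove[OF layers(2) u0, of x] x1[OF u0] by simp
    have "sum x (V2 - {v0, v1}) = sum \<gamma> (V2 - {v0, v1})"
      using x2 by (intro sum.cong) auto
    moreover have "V2 - {v0} - {v1} = V2 - {v0, v1}" by auto
    ultimately have sum2: "sum x V2 = \<alpha> w0 - \<delta>"
      using sum.remove[OF layers(3) v01(1), of x] sum.remove[of "V2 - {v0}" v1 x]
        layers(3) v01 x2 by simp
    have "free x = \<alpha>"
      using \<alpha> w0 x3 by (auto simp: free_def fun_eq_iff sum1 sum2 extensional_def)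
    moreover have "tors x = (\<gamma>, \<delta>, \<epsilon>)"
      unfolding tors_def sum1 using \<gamma> \<delta> \<epsilon> x1 x2 v01
      by (auto simp: fun_eq_iff extensional_def simp del: of_nat_mult)
    ultimately show ?thesis
      unfolding z by blast
  qed
  moreover have "?\<psi> x = \<one>\<^bsub>H\<^esub> \<longleftrightarrow> (\<exists>m.
       (\<forall>u\<in>V1. x u = int (card V2) * m u) \<and>
       (\<forall>v\<in>V2. x v = int (card V3) * m v - sum m V1) \<and>
       (\<forall>w\<in>V3. x w = - sum m V2))" for x
  proof -
    have "free x = (\<lambda>_\<in>V3. 0) \<longleftrightarrow> (\<forall>w\<in>V3. x w = x w0) \<and> int c * x w0 + sum x V2 + sum x V1 = 0"
      using w0 by (auto simp: free_def fun_eq_iff restrict_def)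
    moreover have "(tors x = (\<lambda>_\<in>V2 - {v0, v1}. 0, 0, \<lambda>_\<in>V1 - {u0}. 0))
      \<longleftrightarrow> (\<forall>v\<in>V2 - {v0, v1}. int c dvd x v - x v1)
        \<and> int b * int c dvd int b * x v1 + sum x V1 \<and> (\<forall>u\<in>V1 - {u0}. int b dvd x u)"
      by (auto simp: tors_def fun_eq_iff restrict_def mod_eq_0_iff_dvd)
    ultimately show ?thesis
      unfolding laplacian_image_iff[OF layers(2-4,8) u0 v01 w0]
      by (simp add: H_def b_def c_def)
  qed
  ultimately show "group (Pic G vs)" "Pic G vs \<cong> H"
    using Pic_three_layers_iso[OF sf vs, of H ?\<psi>] by blast+
qed

text \<open>For \<open>V2 = {v0}\<close> the relations say that every \<open>u\<close> in
  \<open>V1\<close> equals \<open>v0\<close> and that \<open>c v0\<close> is the sum of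
  \<open>V3\<close>. The latter eliminates one vertex of \<open>V3\<close>, so the group is free of
  rank \<open>c\<close>. The trivial factor \<open>integer_mod_group 1\<close> gives
  \<open>H\<close> the shape expected by \<open>Pic_Jac_iso\<close>.\<close>

lemma Pic_iso_middle_layer_eq_1:
  assumes sf: "single_flow_multipartite G [V1, V2, V3]"
    and vs: "distinct vs" "set vs = verts G"
    and card: "card V2 = 1"
  defines "H \<equiv> product_group V3 (\<lambda>_. integer_group) \<times>\<times> integer_mod_group 1"
  shows "group (Pic G vs)" "Pic G vs \<cong> H"
proof -
  note layers = single_flow_three_layers[OF sf]
  obtain v0 where V2: "V2 = {v0}"
    using card by (rule card_1_singletonE)
  obtain w0 where w0: "w0 \<in> V3"
    using layers(7) by blast
  define c where "c = card V3"
  define free where "free = (\<lambda>x. \<lambda>w\<in>V3. if w = w0 then int c * x w0 + x v0 + sum x V1 else x w - x w0)"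
  let ?\<psi> = "\<lambda>x. (free x, 0 :: int)"
  have "group H"
    unfolding H_def by (intro DirProd_group product_group) auto
  moreover have "?\<psi> x \<in> carrier H" for x
    by (auto simp: H_def free_def)
  moreover have "?\<psi> (\<lambda>v. x v + y v) = ?\<psi> x \<otimes>\<^bsub>H\<^esub> ?\<psi> y" for x y
    by (simp add: H_def free_def fun_eq_iff sum.distrib algebra_simps)
  moreover have "?\<psi> x = ?\<psi> y" if "\<And>v. v \<in> V1 \<union> V2 \<union> V3 \<Longrightarrow> x v = y v" for x y
  proof -
    have "sum x V1 = sum y V1"
      using that by (auto intro!: sum.cong)
    then show ?thesis
      using that w0 V2 by (auto simp: free_def fun_eq_iff)
  qed
  moreover have "\<exists>x. ?\<psi> x = z" if "z \<in> carrier H" for z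
  proof -
    obtain \<alpha> \<zeta> where "z = (\<alpha>, \<zeta>)" by (cases z)
    with that have z: "z = (\<alpha>, 0)" and \<alpha>: "\<alpha> \<in> extensional V3"
      by (simp_all add: H_def PiE_iff carrier_integer_mod_group)
    define x where "x = (\<lambda>v. if v \<in> V3 then if v = w0 then 0 else \<alpha> v else if v = v0 then \<alpha> w0 else 0)"
    have "sum x V1 = 0"
      using layers(8,9) by (intro sum.neutral) (auto simp: x_def V2)
    then have "free x = \<alpha>"
      using \<alpha> w0 layers(10) by (auto simp: free_def x_def V2 fun_eq_iff extensional_def)
    then show ?thesis
      unfolding z by blast
  qed
  moreover have "?\<psi> x = \<one>\<^bsub>H\<^esub> \<longleftrightarrow> (\<exists>m.
       (\<forall>u\<in>V1. x u = int (card V2) * m u) \<and>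
       (\<forall>v\<in>V2. x v = int (card V3) * m v - sum m V1) \<and>
       (\<forall>w\<in>V3. x w = - sum m V2))" (is "_ \<longleftrightarrow> ?R") for x
  proof -
    have "?\<psi> x = \<one>\<^bsub>H\<^esub> \<longleftrightarrow> (\<forall>w\<in>V3. x w = x w0) \<and> int c * x w0 + x v0 + sum x V1 = 0"
      using w0 by (auto simp: H_def free_def fun_eq_iff restrict_def)
    also have "\<dots> \<longleftrightarrow> ?R"
    proof
      assume L: "(\<forall>w\<in>V3. x w = x w0) \<and> int c * x w0 + x v0 + sum x V1 = 0"
      have "v0 \<notin> V1" using layers(8) V2 by auto
      \<comment> \<open>The summand is the only possible \<open>m\<close>: with \<open>b = 1\<close>
        the equations on \<open>V1\<close> force \<open>m u = x u\<close>, and those on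
        \<open>V3\<close> force \<open>m v0 = - x w0\<close>.\<close>
      then have "(\<Sum>v\<in>V1. if v = v0 then - x w0 else x v) = sum x V1"
        by (intro sum.cong) auto
      then show ?R
        using L \<open>v0 \<notin> V1\<close> by (intro exI[of _ "\<lambda>v. if v = v0 then - x w0 else x v"]) (auto simp: V2 c_def)
    next
      assume ?R
      then obtain m where m: "\<And>u. u \<in> V1 \<Longrightarrow> x u = m u" "x v0 = int c * m v0 - sum m V1"
        "\<And>w. w \<in> V3 \<Longrightarrow> x w = - m v0"
        by (auto simp: V2 c_def)
      have "sum x V1 = sum m V1"
        by (simp add: m(1))
      then show "(\<forall>w\<in>V3. x w = x w0) \<and> int c * x w0 + x v0 + sum x V1 = 0"
        using m w0 by simp
    qed
    finally show ?thesis .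
  qed
  ultimately show "group (Pic G vs)" "Pic G vs \<cong> H"
    using Pic_three_layers_iso[OF sf vs, of H ?\<psi>] by blast+
qed

section \<open>Splitting off the Jacobian and regrouping its cyclic factors\<close>

text \<open>Powers of the integers are torsion-free and \<open>F\<close> is finite, so
  \<open>torsion_iso\<close> identifies the Jacobian with \<open>F\<close>. Reversing this
  isomorphism, which uses that the Jacobian is a group, lets it replace \<open>F\<close> in the
  splitting.\<close>

lemma Pic_Jac_iso:
  assumes "group (Pic G vs)" and iso: "Pic G vs \<cong> product_group V (\<lambda>_. integer_group) \<times>\<times> F"
    and V: "finite V" and F: "group F" "finite (carrier F)"
  shows "Pic G vs \<cong> group_power integer_group (card V) \<times>\<times> Jac G vs"
    "group (Jac G vs)" "Jac G vs \<cong> F"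
proof -
  have iso': "Pic G vs \<cong> group_power integer_group (card V) \<times>\<times> F"
    using iso DirProd_cong[OF group_power_card_iso[OF V] iso_refl] by (rule iso_trans)
  note tors = torsion_iso[OF assms(1) group_group_power F _ iso', folded Jac_def]
  show Jac: "Jac G vs \<cong> F"
    using group_power_integer_torsion_free by (intro tors(2)) auto
  show Jac_group: "group (Jac G vs)"
    using group_power_integer_torsion_free by (intro tors(1)) auto
  have "F \<cong> Jac G vs"
    using Jac_group Jac by (rule group.iso_sym)
  then show "Pic G vs \<cong> group_power integer_group (card V) \<times>\<times> Jac G vs"
    using iso' DirProd_cong[OF iso_refl] iso_trans by blast
qed

text \<open>The exponent is written \<open>a + 1 - b\<close> because subtraction of natural numbers
  truncates: for \<open>a = b - 1\<close> it must be \<open>0\<close>, while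
  \<open>a - b + 1\<close> would give \<open>1\<close>.\<close>

theorem theorem6p6:
  fixes G :: "('v, 'e) pre_digraph"
    and V1 V2 V3 :: "'v set"
    and vs :: "'v list"
    and a b c g l :: nat
  assumes "single_flow_multipartite G [V1, V2, V3]"
    and "card V1 = a" and "card V2 = b" and "card V3 = c"
    and "g = gcd b c" and "l = lcm b c"
    and "distinct vs" and "set vs = verts G"
  shows "Pic G vs \<cong> group_power integer_group c \<times>\<times> Jac G vs
    \<and> (b = 1 \<longrightarrow> trivial_group (Jac G vs))
    \<and> (a \<ge> b - 1 \<and> b \<ge> 2 \<longrightarrow>
        Jac G vs \<cong> group_power (integer_mod_group g) (b - 2)
          \<times>\<times> group_power (integer_mod_group b) (a + 1 - b)
          \<times>\<times> group_power (integer_mod_group l) (b - 2)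
          \<times>\<times> integer_mod_group (b * c))
    \<and> (a \<le> b - 1 \<longrightarrow>
        Jac G vs \<cong> group_power (integer_mod_group g) (a - 1)
          \<times>\<times> group_power (integer_mod_group c) (b - a - 1)
          \<times>\<times> group_power (integer_mod_group l) (a - 1)
          \<times>\<times> integer_mod_group (b * c))"
proof -
  note sf = assms(1) and vs = assms(7,8)
  note layers = single_flow_three_layers[OF sf]
  have abc: "a > 0" "b > 0" "c > 0"
    using layers assms(2-4) by (auto simp: card_gt_0_iff)
  let ?Z = integer_mod_group
  show ?thesis
  proof (cases "b = 1")
    case True
    have "group (?Z 1)" "finite (carrier (?Z 1))"
      by (auto simp: carrier_integer_mod_group)
    note Jac = Pic_Jac_iso[OF Pic_iso_middle_layer_eq_1[OF sf vs True[folded assms(3)]] layers(4) this]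
    have "trivial_group (Jac G vs)"
      using isomorphic_group_triviality[OF Jac(3)] Jac(2) trivial_integer_mod_group by simp
    \<comment> \<open>The clauses with \<open>b \<ge> 2\<close> and \<open>a \<le> b - 1\<close> are
      vacuous here, the latter since \<open>a > 0\<close>.\<close>
    then show ?thesis
      using Jac(1) True abc assms(4) by simp
  next
    case False
    obtain u0 w0 where u0: "u0 \<in> V1" and w0: "w0 \<in> V3"
      using layers by blast
    have "card V2 \<ge> 2" using False abc assms(3) by simp
    then obtain v0 v1 where v01: "v0 \<in> V2" "v1 \<in> V2" "v0 \<noteq> v1"
      by (metis card_2_iff' card_le_Suc0_iff_eq layers(3) not_less_eq_eq numeral_2_eq_2)
    let ?F = "product_group (V2 - {v0, v1}) (\<lambda>_. ?Z c) \<times>\<times> ?Z (b * c)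
       \<times>\<times> product_group (V1 - {u0}) (\<lambda>_. ?Z b)"
    have F: "group ?F" "finite (carrier ?F)"
      using abc layers(2,3)
      by (auto intro!: DirProd_group product_group finite_PiE simp: carrier_integer_mod_group)
    have Jac: "Pic G vs \<cong> group_power integer_group c \<times>\<times> Jac G vs" "Jac G vs \<cong> ?F"
      using Pic_Jac_iso[OF Pic_iso_middle_layer_ge_2[OF sf vs u0 v01 w0, unfolded assms(3,4)] layers(4) F]
      unfolding assms(4) by blast+
    have card: "card (V2 - {v0, v1}) = b - 2" "card (V1 - {u0}) = a - 1"
      using u0 v01 layers(2,3) assms(2,3) by (simp_all add: card_Diff_subset)
    note Jac(2)
    also have "?F \<cong> group_power (?Z c) (b - 2) \<times>\<times> ?Z (b * c) \<times>\<times> group_power (?Z b) (a - 1)"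
      unfolding card[symmetric] using layers(2,3)
      by (intro DirProd_cong iso_refl group_power_card_iso) auto
    finally have Jac': "Jac G vs \<cong> group_power (?Z c) (b - 2) \<times>\<times> ?Z (b * c) \<times>\<times> group_power (?Z b) (a - 1)" .
    have gl: "g = gcd c b" "l = lcm c b"
      using assms by (simp_all add: gcd.commute lcm.commute)
    have swap: "group_power (?Z c) k \<times>\<times> group_power (?Z b) k \<cong> group_power (?Z g) k \<times>\<times> group_power (?Z l) k" for k
      unfolding gl using abc by (intro group_power_gcd_lcm)
    have "Jac G vs \<cong> group_power (?Z g) (b - 2) \<times>\<times> group_power (?Z b) (a + 1 - b)
        \<times>\<times> group_power (?Z l) (b - 2) \<times>\<times> ?Z (b * c)" if "a \<ge> b - 1"
    proof -
      \<comment> \<open>All \<open>b - 2\<close> factors of order \<open>c\<close> find a partner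
        among the \<open>a - 1\<close> factors of order \<open>b\<close>.\<close>
      have "a - 1 = (b - 2) + (a + 1 - b)"
        using that False abc by linarith
      then have "group_power (?Z b) (a - 1) \<cong> group_power (?Z b) (b - 2) \<times>\<times> group_power (?Z b) (a + 1 - b)"
        using group_power_add by metis
      then show ?thesis
        by (intro iso_trans[OF Jac'] iso_trans[OF _ DirProd_rearrange[OF swap]] DirProd_cong iso_refl)
    qed
    moreover have "Jac G vs \<cong> group_power (?Z g) (a - 1) \<times>\<times> group_power (?Z c) (b - a - 1)
        \<times>\<times> group_power (?Z l) (a - 1) \<times>\<times> ?Z (b * c)" if "a \<le> b - 1"
    proof -
      \<comment> \<open>Now all \<open>a - 1\<close> factors of order \<open>b\<close> find a
        partner, and factors of order \<open>c\<close> are left over.\<close>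
      have "b - 2 = (a - 1) + (b - a - 1)"
        using that False abc by linarith
      then have "group_power (?Z c) (b - 2) \<cong> group_power (?Z c) (a - 1) \<times>\<times> group_power (?Z c) (b - a - 1)"
        using group_power_add by metis
      then show ?thesis
        by (intro iso_trans[OF Jac'] iso_trans[OF _ DirProd_rearrange'[OF swap]] DirProd_cong iso_refl)
    qed
    ultimately show ?thesis
      using Jac(1) False by simp
  qed
qed

end
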